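(* Let $C$ be a circle of perimeter $1$, $T$ an equilateral triangle of perimeter $1$, and $R'$ any rectangle of perimeter $1$. Then there is a convex set in $\mathbb{R}^2$ of area at most $0.09763$ which contains a congruent copy (image under a translation and rotation) of each of $R'$, $C$ and $T$. *)

theory Defs
  imports "HOL-Analysis.Analysis"
begin

text \<open>The plane R^2 is modelled as the complex numbers. A congruent copy of S under
a translation and rotation is the image of S under z \<mapsto> c + u * z with |u| = 1.\<close>

definition contains_congruent_copy :: "complex set \<Rightarrow> complex set \<Rightarrow> bool" where
  "contains_congruent_copy K S \<longleftrightarrow> (\<exists>c u. cmod u = 1 \<and> (\<lambda>z. c + u * z) ` S \<subseteq> K)"

definition circle_perim1 :: "complex set" where
  "circle_perim1 = cball 0 (1 / (2 * pi))"

definition triangle_perim1 :: "complex set" where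
  "triangle_perim1 = convex hull {0, complex_of_real (1/3), complex_of_real (1/3) * cis (pi / 3)}"

definition rectangle :: "real \<Rightarrow> real \<Rightarrow> complex set" where
  "rectangle a b = {z. 0 \<le> Re z \<and> Re z \<le> a \<and> 0 \<le> Im z \<and> Im z \<le> b}"

end

theory Submission
  imports Defs
begin

text \<open>Fix the disc at the origin. For each of fifteen ranges of the longer side \<open>a\<close>, the triangle and
  the rectangle's centre keep one place, and the cover is a polygon some of whose vertices may move
  affinely with \<open>a\<close> (mostly corners of the rectangle) while the vertices around the circular arcs
  stand still. All quantities to be controlled -- the side of an edge on which a point lies, and twice
  the area as a sum of cross products of consecutive vertices -- are then quadratic in the parameter,
  so it suffices to inspect their three Bernstein coefficients, which are integers in suitable units.
  Letting the vertices move is essential: the least possible area, as a function of \<open>a\<close>, peaks near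
  \<open>a = 0.463\<close> at about \<open>0.097627\<close>, so there is almost no room for a cover common to several rectangles.
  The placements were found by numerical optimisation.\<close>

section \<open>Area of star-shaped polygons\<close>

text \<open>Twice the signed area of the triangle with vertices \<open>0\<close>, \<open>z\<close>,
  \<open>w\<close>; positive when \<open>w\<close> lies counterclockwise of
  \<open>z\<close>.\<close>

definition cross :: "complex \<Rightarrow> complex \<Rightarrow> real" where
  "cross z w = Re z * Im w - Im z * Re w"

text \<open>A Borel measure giving each box the product of its side lengths is Lebesgue measure.
  This identification with \<open>real ^ 2\<close> makes \<open>content_triangle\<close> usable in
  the complex plane.\<close>

lemma lborel_complex_eq_distr:
  "(lborel :: complex measure) = distr lborel borel (\<lambda>x :: real ^ 2. Complex (x $ 1) (x $ 2))"
proof (rule lborel_eqI)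
  let ?f = "\<lambda>x :: real ^ 2. Complex (x $ 1) (x $ 2)"
  have "continuous_on UNIV ?f"
    by (intro continuous_intros)
  then have meas: "?f \<in> measurable lborel borel"
    using borel_measurable_continuous_onI by auto
  fix l u :: complex
  assume le: "\<And>b. b \<in> Basis \<Longrightarrow> l \<bullet> b \<le> u \<bullet> b"
  let ?v = "\<lambda>z :: complex. vector [Re z, Im z] :: real ^ 2"
  have "?f -` box l u = box (?v l) (?v u)"
    by (auto simp: box_def Basis_complex_def Basis_vec_def inner_axis forall_2 axis_def
        inner_vec_def UNIV_2)
  then have "emeasure (distr lborel borel ?f) (box l u) = emeasure lborel (box (?v l) (?v u))"
    by (subst emeasure_distr[OF meas]) auto
  also have "\<dots> = ennreal (\<Prod>b\<in>Basis. (?v u - ?v l) \<bullet> b)"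
  proof (rule emeasure_lborel_box)
    have "?v l $ i \<le> ?v u $ i" for i
      using le[of 1] le[of \<i>] exhaust_2[of i] by (auto simp: Basis_complex_def)
    then show "?v l \<bullet> b \<le> ?v u \<bullet> b" if "b \<in> Basis" for b
      using that by (auto simp: Basis_vec_def inner_axis)
  qed
  also have "(\<Prod>b\<in>Basis. (?v u - ?v l) \<bullet> b) = (\<Prod>b\<in>Basis. (u - l) \<bullet> b)"
  proof -
    have B: "Basis = {axis 1 1, axis 2 1 :: real ^ 2}"
      by (auto simp: Basis_vec_def) (metis exhaust_2)
    have "axis 1 1 \<noteq> (axis 2 1 :: real ^ 2)"
      by (simp add: axis_eq_axis)
    then show ?thesis
      by (simp add: B inner_axis Basis_complex_def)
  qed
  finally show "emeasure (distr lborel borel ?f) (box l u) = ennreal (\<Prod>b\<in>Basis. (u - l) \<bullet> b)" .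
qed simp

text \<open>The coordinate map is a linear bijection preserving Lebesgue measure, so it takes hulls
  to hulls and carries \<open>content_triangle\<close> over.\<close>

lemma emeasure_triangle_origin:
  "emeasure lebesgue (convex hull {0, u, v}) = ennreal (\<bar>cross u v\<bar> / 2)"
proof -
  let ?f = "\<lambda>x :: real ^ 2. Complex (x $ 1) (x $ 2)"
  let ?v = "\<lambda>z :: complex. vector [Re z, Im z] :: real ^ 2"
  have fv [simp]: "?f (?v z) = z" for z
    by (simp add: complex_eq_iff)
  have vf [simp]: "vector [x $ 1, x $ 2] = x" for x :: "real ^ 2"
    unfolding vec_eq_iff forall_2 by simp
  have lin: "linear ?f"
    by (auto intro!: linearI simp: complex_eq_iff)
  have "continuous_on UNIV ?f"
    by (intro continuous_intros)
  then have meas: "?f \<in> measurable lborel borel"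
    using borel_measurable_continuous_onI by auto
  have closed: "closed (convex hull {0, u, v})" "closed (convex hull {?v 0, ?v u, ?v v})"
    by (auto intro!: compact_imp_closed finite_imp_compact_convex_hull)
  have bij: "bij ?f"
    by (rule o_bij[of ?v]) (auto simp: fun_eq_iff)
  have img: "?f ` (convex hull {?v 0, ?v u, ?v v}) = convex hull {0, u, v}"
    by (subst convex_hull_linear_image[OF lin]) (simp flip: zero_complex.code)
  have "?f -` (convex hull {0, u, v}) = convex hull {?v 0, ?v u, ?v v}"
    unfolding img[symmetric] using bij by (simp add: bij_is_inj inj_vimage_image_eq)
  then have "emeasure lborel (convex hull {0, u, v}) =
      emeasure lborel (convex hull {?v 0, ?v u, ?v v})"
    using closed by (subst lborel_complex_eq_distr) (simp add: emeasure_distr[OF meas])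
  also have "\<dots> = ennreal (measure lborel (convex hull {?v 0, ?v u, ?v v}))"
  proof (rule emeasure_eq_ennreal_measure)
    have "emeasure lborel (convex hull {?v 0, ?v u, ?v v}) < \<infinity>"
      by (intro emeasure_bounded_finite finite_imp_bounded_convex_hull) simp
    then show "emeasure lborel (convex hull {?v 0, ?v u, ?v v}) \<noteq> top" by simp
  qed
  also have "\<dots> = ennreal (\<bar>cross u v\<bar> / 2)"
    by (subst content_triangle) (simp add: cross_def abs_minus_commute mult.commute)
  finally show ?thesis
    using closed by simp
qed

text \<open>Cramer's rule in the basis \<open>v\<close>, \<open>w\<close>.\<close>

lemma cross_cone_decomposition:
  assumes "cross v w \<noteq> 0"
  shows "z = (cross z w / cross v w) *\<^sub>R v + (cross v z / cross v w) *\<^sub>R w"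
proof -
  have "cross v w *\<^sub>R z = cross z w *\<^sub>R v + cross v z *\<^sub>R w"
    by (simp add: complex_eq_iff cross_def algebra_simps)
  then have "z = inverse (cross v w) *\<^sub>R (cross z w *\<^sub>R v + cross v z *\<^sub>R w)"
    using assms by (metis left_inverse scaleR_one scaleR_scaleR)
  then show ?thesis
    by (simp add: scaleR_add_right divide_inverse mult.commute)
qed

text \<open>Otherwise the vertices strictly on one side of the line through \<open>0\<close> and \<open>z\<close> are closed under
  successors; but there the cotangent of the angle to \<open>z\<close> is strictly monotone along edges.\<close>

lemma exists_edge_around:
  assumes fin: "finite V" "V \<noteq> {}"
    and succ: "\<And>v. v \<in> V \<Longrightarrow> \<exists>w\<in>V. (v, w) \<in> E"
    and pos: "\<And>v w. (v, w) \<in> E \<Longrightarrow> cross v w > 0"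
    and "z \<noteq> 0"
  shows "\<exists>(v, w)\<in>E. cross v z \<ge> 0 \<and> cross z w \<ge> 0"
proof (rule ccontr)
  assume no: "\<not> ?thesis"
  define f where "f v = - (v \<bullet> z) / cross v z" for v
  have anti: "cross z w = - cross w z" for w
    by (simp add: cross_def)
  have step: "f w < f v" if "(v, w) \<in> E" "cross v z * cross w z > 0" for v w
  proof -
    have ne: "cross v z \<noteq> 0" "cross w z \<noteq> 0"
      using that(2) by auto
    have "f v - f w = ((w \<bullet> z) * cross v z - (v \<bullet> z) * cross w z) / (cross v z * cross w z)"
      using ne by (simp add: f_def field_simps)
    \<comment> \<open>Up to lengths this is the subtraction formula for the sine: the angles from
      \<open>v\<close> and from \<open>w\<close> to \<open>z\<close> differ by the angle from
      \<open>v\<close> to \<open>w\<close>.\<close>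
    also have "(w \<bullet> z) * cross v z - (v \<bullet> z) * cross w z = (z \<bullet> z) * cross v w"
      by (simp add: cross_def inner_complex_def algebra_simps power2_eq_square)
    also have "(z \<bullet> z) * cross v w / (cross v z * cross w z) > 0"
      using pos[OF that(1)] that(2) \<open>z \<noteq> 0\<close> by (simp add: zero_less_mult_iff[of "z \<bullet> z"])
    finally show ?thesis by simp
  qed
  \<comment> \<open>A minimiser of \<open>f\<close> on a nonempty such \<open>W\<close> would have a
    successor in \<open>W\<close> with a smaller value.\<close>
  have closed: "W = {}" if W: "W \<subseteq> V"
    and sgn: "\<And>v w. v \<in> W \<Longrightarrow> w \<in> V \<Longrightarrow> (v, w) \<in> E \<Longrightarrow> w \<in> W \<and> cross v z * cross w z > 0" for W
  proof (rule ccontr)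
    assume "W \<noteq> {}"
    moreover have "finite W"
      using W fin(1) by (rule finite_subset)
    ultimately obtain v where v: "v \<in> W" "\<And>w. w \<in> W \<Longrightarrow> f v \<le> f w"
      using arg_min_if_finite[of W f] by (metis not_less)
    obtain w where "w \<in> V" "(v, w) \<in> E"
      using succ v(1) W by blast
    with sgn[OF v(1)] step v(2)[of w] show False by fastforce
  qed
  \<comment> \<open>An edge starting strictly on this side passes the first test, so it fails the
    second, and its end is strictly on the same side.\<close>
  have "{v \<in> V. cross v z > 0} = {}"
  proof (intro closed)
    fix v w assume v: "v \<in> {v \<in> V. cross v z > 0}" and w: "w \<in> V" "(v, w) \<in> E"
    have "\<not> (cross v z \<ge> 0 \<and> cross z w \<ge> 0)" using no w(2) by blast
    then show "w \<in> {v \<in> V. cross v z > 0} \<and> cross v z * cross w z > 0"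
      using v w(1) by (simp add: anti)
  qed auto
  then have le: "cross v z \<le> 0" if "v \<in> V" for v
    using that by force
  \<comment> \<open>A vertex on the line itself would have its successor on the side just shown to
    be empty. Hence all of \<open>V\<close> lies strictly on the other side.\<close>
  have lt: "cross v z < 0" if "v \<in> V" for v
  proof -
    obtain w where "w \<in> V" "(v, w) \<in> E"
      using succ \<open>v \<in> V\<close> by blast
    then have "\<not> (cross v z \<ge> 0 \<and> cross z w \<ge> 0)" using no by blast
    then show ?thesis
      using le[OF \<open>w \<in> V\<close>] le[OF that] by (simp add: anti)
  qed
  then have "V = {}"
    by (intro closed) (auto simp: mult_neg_neg)
  with fin(2) show False by simp
qed

section \<open>Polygons as intersections of half-planes\<close>

definition cyclic_edges :: "'a list \<Rightarrow> ('a \<times> 'a) list" where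
  "cyclic_edges vs = zip vs (rotate1 vs)"

lemma cyclic_edges_successor:
  assumes "v \<in> set vs"
  shows "\<exists>w\<in>set vs. (v, w) \<in> set (cyclic_edges vs)"
proof -
  obtain i where i: "i < length vs" "v = vs ! i"
    using assms by (auto simp: in_set_conv_nth)
  then have "(v, rotate1 vs ! i) \<in> set (cyclic_edges vs)"
    by (auto simp: cyclic_edges_def set_zip)
  moreover have "rotate1 vs ! i \<in> set vs"
    using i by (metis length_rotate1 nth_mem set_rotate1)
  ultimately show ?thesis by blast
qed

lemma cyclic_edges_map: "cyclic_edges (map f vs) = map (map_prod f f) (cyclic_edges vs)"
  by (simp add: cyclic_edges_def rotate1_map zip_map_map map_prod_def)

text \<open>An intersection of half-planes is convex whatever the vertices are, and membership is a
  test against each edge. A hull of the vertices would offer neither the disc test nor the area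
  bound so directly.\<close>

definition edge_region :: "(complex \<times> complex) list \<Rightarrow> complex set" where
  "edge_region es = {z. \<forall>(v, w)\<in>set es. cross (w - v) (z - v) \<ge> 0}"

lemma convex_edge_region: "convex (edge_region es)"
proof -
  have "convex {z. cross (w - v) (z - v) \<ge> 0}" for v w
  proof -
    \<comment> \<open>\<open>cross d x\<close> is the inner product of \<open>x\<close> with
      \<open>d\<close> turned by a right angle.\<close>
    have "{z. cross (w - v) (z - v) \<ge> 0} = {z. (Complex (- Im (w - v)) (Re (w - v))) \<bullet> z \<ge>
        (Complex (- Im (w - v)) (Re (w - v))) \<bullet> v}"
      by (auto simp: cross_def inner_complex_def algebra_simps)
    then show ?thesis by (simp only: convex_halfspace_ge)
  qed
  moreover have "edge_region es = (\<Inter>(v, w)\<in>set es. {z. cross (w - v) (z - v) \<ge> 0})"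
    by (auto simp: edge_region_def)
  ultimately show ?thesis by (auto intro!: convex_INT)
qed

lemma emeasure_Union_triangles_le:
  assumes "\<And>v w. (v, w) \<in> set es \<Longrightarrow> cross v w > 0"
  shows "emeasure lebesgue (\<Union>(v, w)\<in>set es. convex hull {0, v, w})
    \<le> ennreal (sum_list (map (\<lambda>(v, w). cross v w) es) / 2)"
  using assms
proof (induction es)
  case (Cons e es)
  obtain v w where e: "e = (v, w)" by force
  have meas: "convex hull {0, v, w} \<in> sets lebesgue" for v w :: complex
    by (intro sets_completionI_sets)
      (auto intro!: borel_closed compact_imp_closed finite_imp_compact_convex_hull)
  have nn: "0 \<le> sum_list (map (\<lambda>(v, w). cross v w) es)"
    using Cons.prems by (intro sum_list_nonneg) (force simp: less_imp_le)
  have "emeasure lebesgue (\<Union>(v, w)\<in>set (e # es). convex hull {0, v, w})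
      \<le> emeasure lebesgue (convex hull {0, v, w}) +
        emeasure lebesgue (\<Union>(v, w)\<in>set es. convex hull {0, v, w})"
  proof -
    have *: "(\<Union>(v, w)\<in>set (e # es). convex hull {0, v, w}) =
        convex hull {0, v, w} \<union> (\<Union>(v, w)\<in>set es. convex hull {0, v, w})"
      by (simp add: e)
    have "(\<Union>(v, w)\<in>set es. convex hull {0, v, w}) \<in> sets lebesgue"
      by (rule sets.finite_UN) (auto intro: meas)
    then show ?thesis
      unfolding * by (rule emeasure_subadditive[OF meas])
  qed
  also have "\<dots> \<le> ennreal (cross v w / 2) + ennreal (sum_list (map (\<lambda>(v, w). cross v w) es) / 2)"
  proof (intro add_mono)
    have "cross v w > 0" using Cons.prems by (simp add: e)
    then show "emeasure lebesgue (convex hull {0, v, w}) \<le> ennreal (cross v w / 2)"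
      by (simp only: emeasure_triangle_origin) simp
  qed (use Cons in simp)
  also have "\<dots> = ennreal (sum_list (map (\<lambda>(v, w). cross v w) (e # es)) / 2)"
    using nn Cons.prems[of v w] by (simp add: e add_divide_distrib flip: ennreal_plus)
  finally show ?case .
qed simp

text \<open>Every point of the region lies in the cone spanned by some edge, and being left of that
  edge puts it in the triangle of the edge with the origin. Subadditivity then bounds the
  area.\<close>

lemma emeasure_polygon_le:
  assumes "vs \<noteq> []"
    and pos: "\<And>v w. (v, w) \<in> set (cyclic_edges vs) \<Longrightarrow> cross v w > 0"
  shows "emeasure lebesgue (edge_region (cyclic_edges vs))
    \<le> ennreal (sum_list (map (\<lambda>(v, w). cross v w) (cyclic_edges vs)) / 2)"
proof -
  have "edge_region (cyclic_edges vs) \<subseteq> (\<Union>(v, w)\<in>set (cyclic_edges vs). convex hull {0, v, w})"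
  proof
    fix z assume z: "z \<in> edge_region (cyclic_edges vs)"
    have "\<exists>(v, w)\<in>set (cyclic_edges vs). cross v z \<ge> 0 \<and> cross z w \<ge> 0"
    proof (cases "z = 0")
      case True
      then show ?thesis
        using cyclic_edges_successor[of "hd vs" vs] \<open>vs \<noteq> []\<close> by (auto simp: cross_def)
    next
      case False
      then show ?thesis
        using \<open>vs \<noteq> []\<close> pos
        by (intro exists_edge_around[of "set vs"]) (auto intro: cyclic_edges_successor)
    qed
    then obtain v w where vw: "(v, w) \<in> set (cyclic_edges vs)" "cross v z \<ge> 0" "cross z w \<ge> 0"
      by blast
    have p: "cross v w > 0" using pos vw(1) by blast
    \<comment> \<open>Being left of the edge means that the two cone coefficients have sum at most
      one.\<close>
    have "cross (w - v) (z - v) \<ge> 0"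
      using z vw(1) by (auto simp: edge_region_def)
    then have "cross z w + cross v z \<le> cross v w"
      by (simp add: cross_def algebra_simps)
    then have le: "cross z w / cross v w + cross v z / cross v w \<le> 1"
      using p by (simp add: field_simps)
    define a b where "a = cross z w / cross v w" and "b = cross v z / cross v w"
    have ab: "a \<ge> 0" "b \<ge> 0" "a + b \<le> 1"
      using vw p le by (auto simp: a_def b_def)
    have "z = a *\<^sub>R v + b *\<^sub>R w"
      using cross_cone_decomposition[of v w z] p by (auto simp: a_def b_def)
    then have "z = (1 - a - b) *\<^sub>R 0 + a *\<^sub>R v + b *\<^sub>R w" by simp
    then have "z \<in> convex hull {0, v, w}"
      unfolding convex_hull_3 using ab
      by (intro CollectI exI[of _ "1 - a - b"] exI[of _ a] exI[of _ b]) simp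
    with vw(1) show "z \<in> (\<Union>(v, w)\<in>set (cyclic_edges vs). convex hull {0, v, w})" by blast
  qed
  moreover have "(\<Union>(v, w)\<in>set (cyclic_edges vs). convex hull {0, v, w}) \<in> sets lebesgue"
    by (intro sets.finite_UN; auto intro!: sets_completionI_sets borel_closed compact_imp_closed
        finite_imp_compact_convex_hull)
  ultimately show ?thesis
    using emeasure_Union_triangles_le[OF pos] by (meson emeasure_mono order_trans)
qed

section \<open>Moving polygons with integer coordinates\<close>

type_synonym ipoint = "int \<times> int"

text \<open>Coordinates are in units of \<open>10\<^sup>-\<^sup>7\<close>; a motion goes affinely from its first to its second
  point.\<close>

type_synonym motion = "ipoint \<times> ipoint"

text \<open>The component \<open>tri_dir = (p, q, s)\<close> is the rotation \<open>u = (p + q\<i>) / s\<close> of the triangle. Its first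
  vertex has integer coordinates, the other two lie in integer unit squares with the given lower left
  corners. The half widths are the two extreme values of \<open>a / 2\<close>; the half height is always
  \<open>2500000\<close> minus the half width, as \<open>a + b = 1 / 2\<close>.\<close>

record certificate =
  half_widths :: "int \<times> int"
  rect_centre :: ipoint
  tri_dir :: "int \<times> int \<times> int"
  tri_vertex :: ipoint
  tri_box1 :: ipoint
  tri_box2 :: ipoint
  polygon :: "motion list"

section \<open>Integer tests on a certificate\<close>

definition still :: "ipoint \<Rightarrow> motion" where
  "still p = (p, p)"

definition icross :: "ipoint \<Rightarrow> ipoint \<Rightarrow> int" where
  "icross p q = fst p * snd q - snd p * fst q"

text \<open>The middle coefficient is doubled, which keeps it an integer.\<close>

definition bernstein :: "motion \<Rightarrow> motion \<Rightarrow> int \<times> int \<times> int" where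
  "bernstein p q = (icross (fst p) (fst q), icross (fst p) (snd q) + icross (snd p) (fst q),
     icross (snd p) (snd q))"

definition box_corners :: "ipoint \<Rightarrow> ipoint list" where
  "box_corners p = [p, p + (1, 0), p + (0, 1), p + (1, 1)]"

definition rect_corners :: "ipoint \<Rightarrow> int \<Rightarrow> ipoint list" where
  "rect_corners c h = [c + (h, 2500000 - h), c + (h, h - 2500000), c + (- h, 2500000 - h),
     c + (- h, h - 2500000)]"

text \<open>At each time the hull of these points contains the triangle and the current rectangle,
  so a convex cover need only contain them. Zipping pairs each corner of the first rectangle with
  the same corner of the last.\<close>

definition targets :: "certificate \<Rightarrow> motion list" where
  "targets C = map still (tri_vertex C # box_corners (tri_box1 C) @ box_corners (tri_box2 C)) @
     zip (rect_corners (rect_centre C) (fst (half_widths C)))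
       (rect_corners (rect_centre C) (snd (half_widths C)))"

definition inorm2 :: "ipoint \<Rightarrow> int" where
  "inorm2 p = fst p * fst p + snd p * snd p"

definition left_of_edge :: "motion \<Rightarrow> motion \<times> motion \<Rightarrow> bool" where
  "left_of_edge q e = (case bernstein (snd e - fst e) (q - fst e) of (c0, c1, c2) \<Rightarrow>
     0 \<le> c0 \<and> 0 \<le> c1 \<and> 0 \<le> c2)"

text \<open>\<open>1591550\<close> is an upper bound for the radius \<open>10\<^sup>7 / (2\<pi>)\<close>. The length of the edge is convex in the
  parameter, hence bounded by the interpolation of the end lengths, whose doubled middle Bernstein
  coefficient is the sum of the two; the second disjunct uses \<open>(x + y)\<^sup>2 \<le> 2 (x\<^sup>2 + y\<^sup>2)\<close>.\<close>

definition disc_left_of_edge :: "motion \<times> motion \<Rightarrow> bool" where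
  "disc_left_of_edge e = (case bernstein (fst e) (snd e) of (c0, c1, c2) \<Rightarrow>
     let l0 = 1591550 * 1591550 * inorm2 (fst (snd e - fst e));
         l1 = 1591550 * 1591550 * inorm2 (snd (snd e - fst e))
     in 0 < c0 \<and> 0 < c1 \<and> 0 < c2 \<and> l0 \<le> c0 * c0 \<and> l1 \<le> c2 * c2 \<and>
       (c0 + c2 \<le> c1 \<or> 2 * (l0 + l1) \<le> c1 * c1))"

text \<open>\<open>19526000000000 = 2 * 0.09763 * 10\<^sup>1\<^sup>4\<close>.\<close>

definition area_ok :: "(motion \<times> motion) list \<Rightarrow> bool" where
  "area_ok es = (let bs = map (\<lambda>e. bernstein (fst e) (snd e)) es in
     sum_list (map fst bs) \<le> 19526000000000 \<and>
     sum_list (map (\<lambda>b. fst (snd b)) bs) \<le> 2 * 19526000000000 \<and>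
     sum_list (map (\<lambda>b. snd (snd b)) bs) \<le> 19526000000000)"

text \<open>The conditions on the third vertex are affine in \<open>\<surd>3\<close>, hence need only be checked at a lower and
  an upper bound of \<open>10\<^sup>1\<^sup>1 \<surd>3\<close>.\<close>

definition tri_ok :: "certificate \<Rightarrow> bool" where
  "tri_ok C = (case tri_dir C of (p, q, s) \<Rightarrow> 0 < s \<and> p * p + q * q = s * s \<and>
     (let d1 = tri_box1 C - tri_vertex C; d2 = tri_box2 C - tri_vertex C in
       3 * s * fst d1 \<le> 10000000 * p \<and> 10000000 * p \<le> 3 * s * (fst d1 + 1) \<and>
       3 * s * snd d1 \<le> 10000000 * q \<and> 10000000 * q \<le> 3 * s * (snd d1 + 1) \<and>
       list_all (\<lambda>r.
         60000 * s * fst d2 \<le> p * 100000000000 - q * r \<and>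
         p * 100000000000 - q * r \<le> 60000 * s * (fst d2 + 1) \<and>
         60000 * s * snd d2 \<le> p * r + q * 100000000000 \<and>
         p * r + q * 100000000000 \<le> 60000 * s * (snd d2 + 1))
       [173205080756, 173205080757]))"

definition valid :: "certificate \<Rightarrow> bool" where
  "valid C \<longleftrightarrow> (let es = cyclic_edges (polygon C) in
     polygon C \<noteq> [] \<and> tri_ok C \<and> area_ok es \<and> list_all disc_left_of_edge es \<and>
     list_all (\<lambda>q. list_all (left_of_edge q) es) (targets C))"

section \<open>Soundness of the integer tests\<close>

definition position :: "real \<Rightarrow> motion \<Rightarrow> complex" where
  "position t m = Complex
     (((1 - t) * real_of_int (fst (fst m)) + t * real_of_int (fst (snd m))) / 10 ^ 7)
     (((1 - t) * real_of_int (snd (fst m)) + t * real_of_int (snd (snd m))) / 10 ^ 7)"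

lemma position_still:
  "position t (still p) = Complex (real_of_int (fst p) / 10 ^ 7) (real_of_int (snd p) / 10 ^ 7)"
  by (simp add: position_def still_def algebra_simps)

lemma position_diff: "position t (p - q) = position t p - position t q"
  by (simp add: position_def complex_eq_iff field_simps)

text \<open>Bilinearity of \<open>cross\<close> in two affine motions. The doubled middle
  coefficient absorbs the usual factor 2, and \<open>10 ^ 14\<close> is the square of the unit
  scale.\<close>

lemma cross_position:
  assumes "bernstein p q = (c0, c1, c2)"
  shows "cross (position t p) (position t q) =
    ((1 - t)\<^sup>2 * c0 + t * (1 - t) * c1 + t\<^sup>2 * c2) / 10 ^ 14"
proof -
  have c: "real_of_int c0 = fst (fst p) * snd (fst q) - snd (fst p) * fst (fst q)"
    "real_of_int c1 = fst (fst p) * snd (snd q) - snd (fst p) * fst (snd q) +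
       (fst (snd p) * snd (fst q) - snd (snd p) * fst (fst q))"
    "real_of_int c2 = fst (snd p) * snd (snd q) - snd (snd p) * fst (snd q)"
    using assms by (auto simp: bernstein_def icross_def)
  show ?thesis
    unfolding c cross_def position_def by (simp add: field_simps power2_eq_square)
qed

lemma bernstein_quadratic_pos:
  fixes c0 c1 c2 t :: real
  assumes "0 \<le> t" "t \<le> 1" "0 < c0" "0 < c1" "0 < c2"
  shows "0 < (1 - t)\<^sup>2 * c0 + t * (1 - t) * c1 + t\<^sup>2 * c2"
proof (cases "t = 0")
  case False
  then show ?thesis
    using assms by (intro add_nonneg_pos add_nonneg_nonneg mult_nonneg_nonneg mult_pos_pos) auto
qed (use assms in simp)

lemma cross_left_of_edge:
  assumes "left_of_edge q (v, w)" "0 \<le> t" "t \<le> 1"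
  shows "cross (position t w - position t v) (position t q - position t v) \<ge> 0"
proof -
  obtain c0 c1 c2 where c: "bernstein (w - v) (q - v) = (c0, c1, c2)"
    by (cases "bernstein (w - v) (q - v)")
  then have "0 \<le> c0" "0 \<le> c1" "0 \<le> c2"
    using assms(1) by (auto simp: left_of_edge_def)
  then show ?thesis
    using assms(2,3) by (simp add: cross_position[OF c] flip: position_diff)
qed

lemma norm_position_le:
  assumes "0 \<le> t" "t \<le> 1"
  shows "cmod (position t m) \<le> ((1 - t) * sqrt (inorm2 (fst m)) + t * sqrt (inorm2 (snd m))) / 10 ^ 7"
proof -
  have "position t m = ((1 - t) / 10 ^ 7) *\<^sub>R Complex (fst (fst m)) (snd (fst m)) +
      (t / 10 ^ 7) *\<^sub>R Complex (fst (snd m)) (snd (snd m))"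
    by (simp add: position_def complex_eq_iff add_divide_distrib)
  also have "cmod \<dots> \<le> (1 - t) / 10 ^ 7 * cmod (Complex (fst (fst m)) (snd (fst m))) +
      t / 10 ^ 7 * cmod (Complex (fst (snd m)) (snd (snd m)))"
    using assms by (intro norm_triangle_le) simp
  also have "\<dots> = ((1 - t) * sqrt (inorm2 (fst m)) + t * sqrt (inorm2 (snd m))) / 10 ^ 7"
    by (simp add: cmod_def inorm2_def power2_eq_square add_divide_distrib)
  finally show ?thesis .
qed

text \<open>\<open>cross v w\<close> is the length of the edge times the signed distance of its line
  from the origin, so the second claim keeps that distance at least the rounded radius. Both sides
  are compared through their Bernstein coefficients; the integer test squares them to avoid
  roots.\<close>

lemma disc_left_of_edge_imp:
  assumes "disc_left_of_edge (v, w)" "0 \<le> t" "t \<le> 1"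
  shows "cross (position t v) (position t w) > 0"
    and "1591550 / 10 ^ 7 * cmod (position t w - position t v) \<le> cross (position t v) (position t w)"
proof -
  obtain c0 c1 c2 where c: "bernstein v w = (c0, c1, c2)"
    by (cases "bernstein v w")
  define R :: real where "R = 1591550"
  define n0 n1 where "n0 = sqrt (inorm2 (fst (w - v)))" and "n1 = sqrt (inorm2 (snd (w - v)))"
  have nn: "0 \<le> n0" "0 \<le> n1" "n0\<^sup>2 = inorm2 (fst (w - v))" "n1\<^sup>2 = inorm2 (snd (w - v))"
    by (auto simp: n0_def n1_def inorm2_def)
  have cs: "0 < c0" "0 < c1" "0 < c2"
    and l0: "1591550 * 1591550 * inorm2 (fst (w - v)) \<le> c0 * c0"
    and l1: "1591550 * 1591550 * inorm2 (snd (w - v)) \<le> c2 * c2"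
    and m: "c0 + c2 \<le> c1 \<or> 2 * (1591550 * 1591550 * inorm2 (fst (w - v)) +
      1591550 * 1591550 * inorm2 (snd (w - v))) \<le> c1 * c1"
    using assms(1) c by (simp_all add: disc_left_of_edge_def Let_def)
  show "cross (position t v) (position t w) > 0"
    using bernstein_quadratic_pos[of t c0 c1 c2] cs assms(2,3) by (simp add: cross_position[OF c])
  have sq: "x \<le> y" if "x\<^sup>2 \<le> y\<^sup>2" "0 < y" for x y :: real
    using that by (meson less_imp_le power2_le_imp_le)
  have "(R * n0)\<^sup>2 \<le> (real_of_int c0)\<^sup>2"
    unfolding power_mult_distrib nn R_def
    using of_int_le_iff[where 'a = real, THEN iffD2, OF l0] by (simp add: power2_eq_square)
  then have b0: "R * n0 \<le> c0"
    using cs by - (rule sq, simp_all)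
  have "(R * n1)\<^sup>2 \<le> (real_of_int c2)\<^sup>2"
    unfolding power_mult_distrib nn R_def
    using of_int_le_iff[where 'a = real, THEN iffD2, OF l1] by (simp add: power2_eq_square)
  then have b2: "R * n1 \<le> c2"
    using cs by - (rule sq, simp_all)
  \<comment> \<open>The two ways to bound the middle coefficient: from the two end coefficients, or
    by comparing squares.\<close>
  have b1: "R * (n0 + n1) \<le> c1"
    using m
  proof
    assume "c0 + c2 \<le> c1"
    then have "real_of_int c0 + real_of_int c2 \<le> real_of_int c1" by linarith
    then show ?thesis using b0 b2 by (simp add: algebra_simps)
  next
    assume "2 * (1591550 * 1591550 * inorm2 (fst (w - v)) +
      1591550 * 1591550 * inorm2 (snd (w - v))) \<le> c1 * c1"
    from of_int_le_iff[where 'a = real, THEN iffD2, OF this]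
    have "2 * (R\<^sup>2 * (n0\<^sup>2 + n1\<^sup>2)) \<le> (real_of_int c1)\<^sup>2"
      unfolding nn R_def by (simp add: power2_eq_square)
    moreover have "(R * (n0 + n1))\<^sup>2 \<le> 2 * (R\<^sup>2 * (n0\<^sup>2 + n1\<^sup>2))"
    proof -
      have "(n0 + n1)\<^sup>2 \<le> 2 * (n0\<^sup>2 + n1\<^sup>2)"
        using sum_squares_bound[of n0 n1] by (simp add: power2_sum)
      from mult_left_mono[OF this, of "R\<^sup>2"] show ?thesis
        unfolding power_mult_distrib by (simp add: distrib_left mult.left_commute)
    qed
    ultimately have "(R * (n0 + n1))\<^sup>2 \<le> (real_of_int c1)\<^sup>2"
      by linarith
    then show ?thesis
      using cs by - (rule sq, simp_all)
  qed
  have "R / 10 ^ 7 * cmod (position t w - position t v)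
      \<le> R / 10 ^ 7 * (((1 - t) * n0 + t * n1) / 10 ^ 7)"
    using norm_position_le[OF assms(2,3), of "w - v"]
    by (intro mult_left_mono) (auto simp: position_diff n0_def n1_def R_def)
  \<comment> \<open>Degree elevation: the linear bound is multiplied by
    \<open>(1 - t) + t\<close>.\<close>
  also have "\<dots> = ((1 - t)\<^sup>2 * (R * n0) + t * (1 - t) * (R * (n0 + n1)) + t\<^sup>2 * (R * n1)) / 10 ^ 14"
    by (simp add: power2_eq_square field_simps)
  also have "\<dots> \<le> ((1 - t)\<^sup>2 * c0 + t * (1 - t) * c1 + t\<^sup>2 * c2) / 10 ^ 14"
    using b0 b1 b2 assms(2,3) by (intro divide_right_mono add_mono mult_left_mono) auto
  also have "\<dots> = cross (position t v) (position t w)"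
    by (rule cross_position[OF c, symmetric])
  finally show "1591550 / 10 ^ 7 * cmod (position t w - position t v) \<le> cross (position t v) (position t w)"
    by (simp add: R_def)
qed

lemma abs_cross_le: "\<bar>cross z w\<bar> \<le> cmod z * cmod w"
proof -
  have "cross z w = Im (cnj z * w)"
    by (simp add: cross_def)
  also have "\<bar>\<dots>\<bar> \<le> cmod (cnj z * w)"
    by (rule abs_Im_le_cmod)
  finally show ?thesis by (simp add: norm_mult)
qed

text \<open>Passing from the origin to \<open>z\<close> changes the value at an edge by
  \<open>cross (w - v) z\<close>, at most \<open>r\<close> times the length of the edge, which is
  what the hypothesis leaves as margin.\<close>

lemma disc_subset_edge_region:
  assumes "\<And>v w. (v, w) \<in> set es \<Longrightarrow> r * cmod (w - v) \<le> cross v w"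
  shows "cball 0 r \<subseteq> edge_region es"
proof
  fix z assume z: "z \<in> cball (0 :: complex) r"
  have "cross (w - v) (z - v) \<ge> 0" if "(v, w) \<in> set es" for v w
  proof -
    have "cross (w - v) (z - v) = cross v w + cross (w - v) z"
      by (simp add: cross_def algebra_simps)
    moreover have "\<bar>cross (w - v) z\<bar> \<le> cmod (w - v) * r"
      using abs_cross_le[of "w - v" z] z by (smt (verit) mem_cball_0 mult_left_mono norm_ge_zero)
    ultimately show ?thesis
      using assms[OF that] by (simp add: mult.commute)
  qed
  then show "z \<in> edge_region es"
    by (auto simp: edge_region_def)
qed

lemma sum_cross_position:
  "sum_list (map (\<lambda>(v, w). cross (position t v) (position t w)) es) =
    ((1 - t)\<^sup>2 * sum_list (map fst (map (\<lambda>e. bernstein (fst e) (snd e)) es)) +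
     t * (1 - t) * sum_list (map (\<lambda>b. fst (snd b)) (map (\<lambda>e. bernstein (fst e) (snd e)) es)) +
     t\<^sup>2 * sum_list (map (\<lambda>b. snd (snd b)) (map (\<lambda>e. bernstein (fst e) (snd e)) es))) / 10 ^ 14"
proof (induction es)
  case (Cons e es)
  obtain v w where e: "e = (v, w)" by (cases e)
  obtain c0 c1 c2 where c: "bernstein v w = (c0, c1, c2)"
    by (cases "bernstein v w")
  show ?case
    unfolding list.map sum_list.Cons e prod.case cross_position[OF c] Cons.IH
    by (simp add: c field_simps del: map_map)
qed simp

lemma area_ok_imp:
  assumes "area_ok es" "0 \<le> t" "t \<le> 1"
  shows "sum_list (map (\<lambda>(v, w). cross (position t v) (position t w)) es) / 2 \<le> 0.09763"
proof -
  define S0 S1 S2 where "S0 = sum_list (map fst (map (\<lambda>e. bernstein (fst e) (snd e)) es))"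
    and "S1 = sum_list (map (\<lambda>b. fst (snd b)) (map (\<lambda>e. bernstein (fst e) (snd e)) es))"
    and "S2 = sum_list (map (\<lambda>b. snd (snd b)) (map (\<lambda>e. bernstein (fst e) (snd e)) es))"
  define M :: real where "M = 19526000000000"
  have "S0 \<le> 19526000000000" "S1 \<le> 2 * 19526000000000" "S2 \<le> 19526000000000"
    using assms(1) by (auto simp: area_ok_def Let_def S0_def S1_def S2_def)
  then have S: "real_of_int S0 \<le> M" "real_of_int S1 \<le> 2 * M" "real_of_int S2 \<le> M"
    by (auto simp: M_def)
  \<comment> \<open>The constant \<open>M\<close> has coefficients \<open>M\<close>,
    \<open>2 * M\<close>, \<open>M\<close> in this basis.\<close>
  have "(1 - t)\<^sup>2 * S0 + t * (1 - t) * S1 + t\<^sup>2 * S2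
      \<le> (1 - t)\<^sup>2 * M + t * (1 - t) * (2 * M) + t\<^sup>2 * M"
    using S assms(2,3) by (intro add_mono mult_left_mono) auto
  also have "\<dots> = M"
    by (simp add: power2_eq_square algebra_simps)
  finally show ?thesis
    unfolding sum_cross_position S0_def[symmetric] S1_def[symmetric] S2_def[symmetric]
    by (simp add: M_def)
qed

section \<open>Placing the triangle and the rectangle in a convex set\<close>

lemma convex_contains_box:
  assumes K: "convex K"
    and corners: "Complex x0 y0 \<in> K" "Complex x1 y0 \<in> K"
      "Complex x0 y1 \<in> K" "Complex x1 y1 \<in> K"
    and x: "x0 \<le> x" "x \<le> x1" and y: "y0 \<le> y" "y \<le> y1"
  shows "Complex x y \<in> K"
proof -
  have hor: "Complex x y' \<in> K" if "Complex x0 y' \<in> K" "Complex x1 y' \<in> K" for y'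
  proof -
    have "Complex x y' \<in> closed_segment (Complex x0 y') (Complex x1 y')"
      using x by (simp add: closed_segment_same_Im closed_segment_eq_real_ivl)
    then show ?thesis
      using closed_segment_subset[OF that K] by blast
  qed
  have "Complex x y \<in> closed_segment (Complex x y0) (Complex x y1)"
    using y by (simp add: closed_segment_same_Re closed_segment_eq_real_ivl)
  then show ?thesis
    using closed_segment_subset[OF hor hor K] corners by blast
qed

text \<open>The preimage of \<open>K\<close> under an affine map is convex, so it contains the hull
  once it contains \<open>S\<close>.\<close>

lemma affine_image_convex_hull_subset:
  fixes c u :: complex
  assumes "convex K" "(\<lambda>z. c + u * z) ` S \<subseteq> K"
  shows "(\<lambda>z. c + u * z) ` (convex hull S) \<subseteq> K"
proof -
  have "convex ((\<lambda>z. c + u * z) -` K)"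
  proof (rule convexI)
    fix x y :: complex and a b :: real
    assume "x \<in> (\<lambda>z. c + u * z) -` K" "y \<in> (\<lambda>z. c + u * z) -` K"
      and ab: "0 \<le> a" "0 \<le> b" "a + b = 1"
    then have "a *\<^sub>R (c + u * x) + b *\<^sub>R (c + u * y) \<in> K"
      using assms(1) by (auto intro: convexD)
    also have "a *\<^sub>R (c + u * x) + b *\<^sub>R (c + u * y) = (a + b) *\<^sub>R c + u * (a *\<^sub>R x + b *\<^sub>R y)"
      by (simp add: algebra_simps)
    finally show "a *\<^sub>R x + b *\<^sub>R y \<in> (\<lambda>z. c + u * z) -` K"
      by (simp add: ab)
  qed
  then have "convex hull S \<subseteq> (\<lambda>z. c + u * z) -` K"
    using assms(2) by (intro hull_minimal) auto
  then show ?thesis by blast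
qed

lemma sqrt_3_bounds: "173205080756 \<le> 10 ^ 11 * sqrt 3" "10 ^ 11 * sqrt 3 \<le> 173205080757"
proof -
  have "173205080756 / 10 ^ 11 \<le> sqrt 3"
    by (rule real_le_rsqrt) (simp add: power2_eq_square)
  then show "173205080756 \<le> 10 ^ 11 * sqrt 3" by simp
  have "sqrt 3 \<le> 173205080757 / 10 ^ 11"
    by (rule real_le_lsqrt) (simp_all add: power2_eq_square)
  then show "10 ^ 11 * sqrt 3 \<le> 173205080757" by simp
qed

text \<open>The sign of \<open>q\<close> decides which end of the interval gives the bound.\<close>

lemma linear_between:
  fixes q r :: real
  assumes "L \<le> x + q * r1" "L \<le> x + q * r2" "r1 \<le> r" "r \<le> r2"
  shows "L \<le> x + q * r"
proof (cases "q \<ge> 0")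
  case True
  then have "q * r1 \<le> q * r" using assms(3) by (rule mult_left_mono[rotated])
  then show ?thesis using assms by linarith
next
  case False
  then have "q * r2 \<le> q * r" using assms(4) by (simp add: mult_left_mono_neg)
  then show ?thesis using assms by linarith
qed

lemma contains_triangle:
  assumes K: "convex K" and ok: "tri_ok C"
    and inK: "\<And>p. p \<in> set (tri_vertex C # box_corners (tri_box1 C) @ box_corners (tri_box2 C)) \<Longrightarrow>
      Complex (real_of_int (fst p) / 10 ^ 7) (real_of_int (snd p) / 10 ^ 7) \<in> K"
  shows "contains_congruent_copy K triangle_perim1"
proof -
  obtain p q s where dir: "tri_dir C = (p, q, s)"
    by (cases "tri_dir C")
  obtain cx cy where V: "tri_vertex C = (cx, cy)" by force
  obtain x1 y1 where B1: "tri_box1 C = (x1, y1)" by force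
  obtain x2 y2 where B2: "tri_box2 C = (x2, y2)" by force
  have s: "0 < s" and pyth: "p * p + q * q = s * s"
    and b1: "3 * s * (x1 - cx) \<le> 10000000 * p" "10000000 * p \<le> 3 * s * (x1 - cx + 1)"
      "3 * s * (y1 - cy) \<le> 10000000 * q" "10000000 * q \<le> 3 * s * (y1 - cy + 1)"
    using ok by (auto simp: tri_ok_def dir V B1 B2 Let_def)
  have b2: "60000 * s * (x2 - cx) \<le> p * 100000000000 - q * r"
      "p * 100000000000 - q * r \<le> 60000 * s * (x2 - cx + 1)"
      "60000 * s * (y2 - cy) \<le> p * r + q * 100000000000"
      "p * r + q * 100000000000 \<le> 60000 * s * (y2 - cy + 1)"
    if "r = 173205080756 \<or> r = 173205080757" for r
    using ok that by (auto simp: tri_ok_def dir V B1 B2 Let_def)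
  define c where "c = Complex (cx / 10 ^ 7) (cy / 10 ^ 7)"
  define u where "u = Complex (p / s) (q / s)"
  have rs: "0 < real_of_int s" using s by simp
  \<comment> \<open>The direction is a Pythagorean triple, so \<open>u\<close> has modulus exactly
    one with no rounding.\<close>
  have "(real_of_int p)\<^sup>2 + (real_of_int q)\<^sup>2 = (real_of_int s)\<^sup>2"
    using pyth by (metis of_int_add of_int_mult power2_eq_square)
  then have "cmod u = 1"
    using rs by (simp add: u_def cmod_def power_divide flip: add_divide_distrib)
  moreover have "(\<lambda>z. c + u * z) ` triangle_perim1 \<subseteq> K"
    unfolding triangle_perim1_def
  proof (rule affine_image_convex_hull_subset[OF K])
    have "c + u * 0 \<in> K"
      using inK[of "tri_vertex C"] by (simp add: c_def V)
    moreover have "c + u * complex_of_real (1 / 3) \<in> K"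
    proof -
      have "Complex (cx / 10 ^ 7 + p / s / 3) (cy / 10 ^ 7 + q / s / 3) \<in> K"
      proof (rule convex_contains_box[OF K])
        show "Complex (x1 / 10 ^ 7) (y1 / 10 ^ 7) \<in> K" "Complex ((x1 + 1) / 10 ^ 7) (y1 / 10 ^ 7) \<in> K"
          "Complex (x1 / 10 ^ 7) ((y1 + 1) / 10 ^ 7) \<in> K"
          "Complex ((x1 + 1) / 10 ^ 7) ((y1 + 1) / 10 ^ 7) \<in> K"
          using inK[of "(x1, y1)"] inK[of "(x1 + 1, y1)"] inK[of "(x1, y1 + 1)"] inK[of "(x1 + 1, y1 + 1)"]
          by (simp_all add: box_corners_def B1)
      qed (use b1[THEN of_int_le_iff[where 'a = real, THEN iffD2]] rs in \<open>simp_all add: field_simps\<close>)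
      also have "Complex (cx / 10 ^ 7 + p / s / 3) (cy / 10 ^ 7 + q / s / 3) = c + u * complex_of_real (1 / 3)"
        by (simp add: c_def u_def complex_eq_iff)
      finally show ?thesis .
    qed
    moreover have "c + u * (complex_of_real (1 / 3) * cis (pi / 3)) \<in> K"
    proof -
      \<comment> \<open>In units of 10^-7 the third vertex is offset horizontally by 10^7 (p - q
        sqrt 3) / (6 s) and vertically by 10^7 (p sqrt 3 + q) / (6 s). Multiplying by 60000 s clears
        the denominator and leaves the factor 10^11 for \<open>sqrt 3\<close>.\<close>
      have b2': "60000 * real_of_int s * (x2 - cx) \<le> p * 10 ^ 11 - q * (10 ^ 11 * sqrt 3)"
        "p * 10 ^ 11 - q * (10 ^ 11 * sqrt 3) \<le> 60000 * real_of_int s * (x2 - cx + 1)"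
        "60000 * real_of_int s * (y2 - cy) \<le> p * (10 ^ 11 * sqrt 3) + q * 10 ^ 11"
        "p * (10 ^ 11 * sqrt 3) + q * 10 ^ 11 \<le> 60000 * real_of_int s * (y2 - cy + 1)"
      proof -
        note lo = b2[OF disjI1[OF refl], THEN of_int_le_iff[where 'a = real, THEN iffD2]]
        note hi = b2[OF disjI2[OF refl], THEN of_int_le_iff[where 'a = real, THEN iffD2]]
        show "60000 * real_of_int s * (x2 - cx) \<le> p * 10 ^ 11 - q * (10 ^ 11 * sqrt 3)"
          using linear_between[OF _ _ sqrt_3_bounds,
              of "60000 * real_of_int s * (x2 - cx)"
                "p * 10 ^ 11" "- real_of_int q"]
            lo(1) hi(1)
          by simp
        show "p * 10 ^ 11 - q * (10 ^ 11 * sqrt 3) \<le> 60000 * real_of_int s * (x2 - cx + 1)"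
          using linear_between[OF _ _ sqrt_3_bounds,
              of "- (60000 * real_of_int s * (x2 - cx + 1))"
                "- p * 10 ^ 11" "real_of_int q"]
            lo(2) hi(2)
          by simp
        show "60000 * real_of_int s * (y2 - cy) \<le> p * (10 ^ 11 * sqrt 3) + q * 10 ^ 11"
          using linear_between[OF _ _ sqrt_3_bounds,
              of "60000 * real_of_int s * (y2 - cy)"
                "q * 10 ^ 11" "real_of_int p"]
            lo(3) hi(3)
          by simp
        show "p * (10 ^ 11 * sqrt 3) + q * 10 ^ 11 \<le> 60000 * real_of_int s * (y2 - cy + 1)"
          using linear_between[OF _ _ sqrt_3_bounds,
              of "- (60000 * real_of_int s * (y2 - cy + 1))"
                "- q * 10 ^ 11" "- real_of_int p"]
            lo(4) hi(4)
          by simp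
      qed
      \<comment> \<open>Here \<open>cis (pi / 3)\<close> is (1 + i sqrt 3) / 2, and the side 1 / 3
        supplies the remaining factor of the 6.\<close>
      have "Complex (cx / 10 ^ 7 + (p - q * sqrt 3) / s / 6) (cy / 10 ^ 7 + (p * sqrt 3 + q) / s / 6) \<in> K"
      proof (rule convex_contains_box[OF K])
        show "Complex (x2 / 10 ^ 7) (y2 / 10 ^ 7) \<in> K" "Complex ((x2 + 1) / 10 ^ 7) (y2 / 10 ^ 7) \<in> K"
          "Complex (x2 / 10 ^ 7) ((y2 + 1) / 10 ^ 7) \<in> K"
          "Complex ((x2 + 1) / 10 ^ 7) ((y2 + 1) / 10 ^ 7) \<in> K"
          using inK[of "(x2, y2)"] inK[of "(x2 + 1, y2)"] inK[of "(x2, y2 + 1)"] inK[of "(x2 + 1, y2 + 1)"]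
          by (simp_all add: box_corners_def B2)
      qed (use b2' rs in \<open>simp_all add: field_simps\<close>)
      also have "Complex (cx / 10 ^ 7 + (p - q * sqrt 3) / s / 6) (cy / 10 ^ 7 + (p * sqrt 3 + q) / s / 6) =
          c + u * (complex_of_real (1 / 3) * cis (pi / 3))"
        using rs by (simp add: c_def u_def complex_eq_iff cos_60 sin_60 field_simps)
      finally show ?thesis .
    qed
    ultimately show "(\<lambda>z. c + u * z) ` {0, complex_of_real (1 / 3),
        complex_of_real (1 / 3) * cis (pi / 3)} \<subseteq> K"
      by blast
  qed
  ultimately show ?thesis
    unfolding contains_congruent_copy_def by blast
qed

text \<open>Half width and half height are affine in \<open>a\<close>, so at the time
  \<open>t\<close> when the half width is \<open>a / 2\<close> the moving corners are exactly those
  of the rectangle. The factor 5000000 is \<open>10 ^ 7 / 2\<close>.\<close>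

lemma contains_rectangle:
  assumes K: "convex K" and "a + b = 1 / 2"
    and t: "a * 5000000 = (1 - t) * h0 + t * h1"
    and inK: "\<And>m. m \<in> set (zip (rect_corners c h0) (rect_corners c h1)) \<Longrightarrow> position t m \<in> K"
  shows "contains_congruent_copy K (rectangle a b)"
proof -
  define x y where "x = real_of_int (fst c) / 10 ^ 7" and "y = real_of_int (snd c) / 10 ^ 7"
  have b: "b = 1 / 2 - a" using assms(2) by simp
  have "Complex (x + z) (y + w) \<in> K" if zw: "z \<in> {- a / 2, a / 2}" "w \<in> {- b / 2, b / 2}" for z w
  proof -
    have *: "position t (c + (h0, 2500000 - h0), c + (h1, 2500000 - h1)) = Complex (x + a / 2) (y + b / 2)"
      "position t (c + (h0, h0 - 2500000), c + (h1, h1 - 2500000)) = Complex (x + a / 2) (y + - b / 2)"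
      "position t (c + (- h0, 2500000 - h0), c + (- h1, 2500000 - h1)) = Complex (x + - a / 2) (y + b / 2)"
      "position t (c + (- h0, h0 - 2500000), c + (- h1, h1 - 2500000)) = Complex (x + - a / 2) (y + - b / 2)"
      using t by (simp_all add: position_def x_def y_def b complex_eq_iff field_simps)
    have "position t (c + (h0, 2500000 - h0), c + (h1, 2500000 - h1)) \<in> K"
      "position t (c + (h0, h0 - 2500000), c + (h1, h1 - 2500000)) \<in> K"
      "position t (c + (- h0, 2500000 - h0), c + (- h1, 2500000 - h1)) \<in> K"
      "position t (c + (- h0, h0 - 2500000), c + (- h1, h1 - 2500000)) \<in> K"
      by (rule inK, simp add: rect_corners_def)+
    then show ?thesis
      unfolding * using zw by auto
  qed
  note corner = this
  have "(\<lambda>z. Complex (x - a / 2) (y - b / 2) + 1 * z) ` rectangle a b \<subseteq> K"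
  proof clarify
    fix z assume z: "z \<in> rectangle a b"
    have "Complex (x - a / 2 + Re z) (y - b / 2 + Im z) \<in> K"
      using corner[of "- a / 2" "- b / 2"] corner[of "a / 2" "- b / 2"]
        corner[of "- a / 2" "b / 2"] corner[of "a / 2" "b / 2"] z
      by - (rule convex_contains_box[OF K, of "x - a / 2" "y - b / 2" "x + a / 2" "y + b / 2"],
          auto simp: rectangle_def)
    also have "Complex (x - a / 2 + Re z) (y - b / 2 + Im z) = Complex (x - a / 2) (y - b / 2) + 1 * z"
      by (simp add: complex_eq_iff)
    finally show "Complex (x - a / 2) (y - b / 2) + 1 * z \<in> K" .
  qed
  then show ?thesis
    unfolding contains_congruent_copy_def by (metis norm_one)
qed

section \<open>One certificate covers a whole range of rectangles\<close>

lemma inverse_two_pi_le: "1 / (2 * pi) \<le> 1591550 / 10 ^ 7"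
proof -
  have "1 / (2 * pi) \<le> 1 / (2 * 3.141592653588)"
    using pi_approx(1) by (intro divide_left_mono) auto
  also have "\<dots> \<le> 1591550 / 10 ^ 7" by simp
  finally show ?thesis .
qed

text \<open>\<open>K\<close> is the polygon frozen at the time when the moving rectangle has sides
  \<open>a\<close> and \<open>b\<close>. Each test holds at all times in the unit interval, hence at
  this one.\<close>

lemma valid_imp_cover:
  assumes val: "valid C" and hw: "half_widths C = (h0, h1)" "h0 < h1"
    and a: "h0 \<le> 5000000 * a" "5000000 * a \<le> h1" and ab: "a + b = 1 / 2"
  shows "\<exists>K. convex K \<and> emeasure lebesgue K \<le> ennreal 0.09763 \<and>
    contains_congruent_copy K (rectangle a b) \<and> contains_congruent_copy K circle_perim1 \<and>
    contains_congruent_copy K triangle_perim1"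
proof -
  define t where "t = (5000000 * a - h0) / (h1 - h0)"
  have t: "0 \<le> t" "t \<le> 1" "a * 5000000 = (1 - t) * h0 + t * h1"
  proof -
    have pos: "0 < real_of_int h1 - real_of_int h0" using hw(2) by simp
    then show "0 \<le> t" "t \<le> 1" using a by (simp_all add: t_def)
    have "t * (h1 - h0) = 5000000 * a - h0" using pos by (simp add: t_def)
    then show "a * 5000000 = (1 - t) * h0 + t * h1" by (simp add: algebra_simps)
  qed
  define es where "es = cyclic_edges (polygon C)"
  define vs where "vs = map (position t) (polygon C)"
  define K where "K = edge_region (cyclic_edges vs)"
  have ok: "polygon C \<noteq> []" "tri_ok C" "area_ok es"
    "\<And>v w. (v, w) \<in> set es \<Longrightarrow> disc_left_of_edge (v, w)"
    "\<And>q v w. q \<in> set (targets C) \<Longrightarrow> (v, w) \<in> set es \<Longrightarrow> left_of_edge q (v, w)"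
    using val by (auto simp: valid_def Let_def es_def list_all_iff)
  have es: "cyclic_edges vs = map (map_prod (position t) (position t)) es"
    by (simp add: vs_def es_def cyclic_edges_map)
  have K: "convex K"
    by (simp add: K_def convex_edge_region)
  have tgt: "position t q \<in> K" if "q \<in> set (targets C)" for q
  proof -
    have "cross (position t w - position t v) (position t q - position t v) \<ge> 0"
      if "(v, w) \<in> set es" for v w
      using ok(5)[OF \<open>q \<in> set (targets C)\<close> that] t(1,2) by (rule cross_left_of_edge)
    then show ?thesis
      by (auto simp: K_def edge_region_def es)
  qed
  have "emeasure lebesgue K \<le> ennreal (sum_list (map (\<lambda>(v, w). cross v w) (cyclic_edges vs)) / 2)"
    unfolding K_def
  proof (rule emeasure_polygon_le)
    show "vs \<noteq> []" using ok(1) by (simp add: vs_def)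
    show "cross v w > 0" if "(v, w) \<in> set (cyclic_edges vs)" for v w
      using that ok(4) disc_left_of_edge_imp(1) t by (auto simp: es)
  qed
  also have "\<dots> \<le> ennreal 0.09763"
  proof (rule ennreal_leI)
    have "map (\<lambda>(v, w). cross v w) (cyclic_edges vs) =
        map (\<lambda>(v, w). cross (position t v) (position t w)) es"
      by (auto simp: es)
    then show "sum_list (map (\<lambda>(v, w). cross v w) (cyclic_edges vs)) / 2 \<le> 0.09763"
      using area_ok_imp[OF ok(3) t(1,2)] by simp
  qed
  finally have area: "emeasure lebesgue K \<le> ennreal 0.09763" .
  have "cball 0 (1591550 / 10 ^ 7) \<subseteq> K"
    unfolding K_def
    using ok(4) disc_left_of_edge_imp(2) t by (intro disc_subset_edge_region) (auto simp: es)
  then have "(\<lambda>z. 0 + 1 * z) ` circle_perim1 \<subseteq> K"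
    using inverse_two_pi_le by (auto simp: circle_perim1_def)
  then have circle: "contains_congruent_copy K circle_perim1"
    unfolding contains_congruent_copy_def by (metis norm_one)
  have triangle: "contains_congruent_copy K triangle_perim1"
  proof (rule contains_triangle[OF K ok(2)])
    fix p assume "p \<in> set (tri_vertex C # box_corners (tri_box1 C) @ box_corners (tri_box2 C))"
    then have "still p \<in> set (targets C)"
      unfolding targets_def by auto
    then show "Complex (real_of_int (fst p) / 10 ^ 7) (real_of_int (snd p) / 10 ^ 7) \<in> K"
      using tgt[of "still p"] by (simp add: position_still)
  qed
  have "contains_congruent_copy K (rectangle a b)"
    by (rule contains_rectangle[OF K ab t(3), where c = "rect_centre C"])
      (rule tgt, simp add: targets_def hw)
  with K area circle triangle show ?thesis by blast
qed

text \<open>A quarter turn followed by a shift by \<open>b\<close> takes one rectangle onto the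
  other, so no reflection is involved.\<close>

lemma contains_congruent_copy_rectangle_swap:
  assumes "contains_congruent_copy K (rectangle b a)"
  shows "contains_congruent_copy K (rectangle a b)"
proof -
  obtain c u where cu: "cmod u = 1" "(\<lambda>z. c + u * z) ` rectangle b a \<subseteq> K"
    using assms by (auto simp: contains_congruent_copy_def)
  have "(\<lambda>z. (c + u * of_real b) + (u * \<i>) * z) ` rectangle a b \<subseteq> K"
  proof clarify
    fix z assume "z \<in> rectangle a b"
    then have "of_real b + \<i> * z \<in> rectangle b a"
      by (auto simp: rectangle_def)
    then have "c + u * (of_real b + \<i> * z) \<in> K"
      using cu(2) by blast
    then show "(c + u * of_real b) + (u * \<i>) * z \<in> K"
      by (simp add: algebra_simps)
  qed
  moreover have "cmod (u * \<i>) = 1"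
    using cu(1) by (simp add: norm_mult)
  ultimately show ?thesis
    unfolding contains_congruent_copy_def by blast
qed

section \<open>The certificates\<close>

text \<open>The suffix is the left end of the range of \<open>a\<close>, in units of \<open>10\<^sup>-\<^sup>4\<close>.\<close>

definition cert_2500 :: certificate where
  "cert_2500 = \<lparr>half_widths = (1250000, 1750000), rect_centre = (-49540, -155633),
     tri_dir = (8397579, -899620, 8445629), tri_vertex = (-1799540, -995547),
     tri_box1 = (1514828, -1350611), tri_box2 = (165138, 1697248),
     polygon = [
      still (-1799540, -995547), still (-1299540, -1405633), still (-118776, -1592569),
      still (144646, -1590428), still (1514830, -1350612), still (1700460, -905633),
      still (1700460, 594367), still (1200460, 1094367), still (830892, 1363873),
      still (165139, 1697251), still (-612320, 1481861), still (-1299540, 1094367),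
      still (-1799540, 594367)]\<rparr>"

definition cert_3500 :: certificate where
  "cert_3500 = \<lparr>half_widths = (1750000, 1900000), rect_centre = (-10546, 276340),
     tri_dir = (4657371, -7711300, 9008621), tri_vertex = (-1760547, 1026340),
     tri_box1 = (-37246, -1826964), tri_box2 = (1572137, 1092110),
     polygon = [
      still (-1910546, -323660), still (-1064174, -1188049), still (-899926, -1316837),
      still (-37246, -1826966), still (864789, -1342056), still (1065559, -1188932),
      still (1889454, -323660), still (1889454, 876340), still (1739454, 1026340),
      still (1572140, 1092112), still (397884, 1553694), still (4879, 1603824),
      still (-388424, 1556086), still (-1760547, 1026340), still (-1910546, 876340)]\<rparr>"

definition cert_3800 :: certificate where
  "cert_3800 = \<lparr>half_widths = (1900000, 2000000), rect_centre = (355599, -5507),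
     tri_dir = (1463595, 1378628, 2010653), tri_vertex = (-70802, -1744798),
     tri_box1 = (2355598, 540741), tri_box2 = (-836937, 1499296),
     polygon = [
      still (-1644401, -505507), still (-1159277, -1096118), still (-995597, -1246670),
      still (-812572, -1372999), still (-70802, -1744798), still (672348, -1444937),
      still (2255599, -605507), still (2355599, -505507), still (2355601, 540742),
      still (645078, 1460159), still (412855, 1541993), still (170810, 1587141),
      still (-75299, 1594529), still (-836938, 1499299), still (-1644401, 494493)]\<rparr>"

definition cert_4000 :: certificate where
  "cert_4000 = \<lparr>half_widths = (2000000, 2100000), rect_centre = (-303815, -6790),
     tri_dir = (6440560, -2367522, 6861922), tri_vertex = (-2403815, -406790),
     tri_box1 = (724832, -1556868), tri_box2 = (156504, 1727659),
     polygon = [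
      still (-2403815, -406790), still (-2303815, -506790), still (-730331, -1416146),
      still (-591560, -1479496), still (-447367, -1529286), still (-299073, -1565059),
      still (-148038, -1586486), still (4354, -1593372), still (724834, -1556870),
      still (1796185, -406790), still (1796185, 393210), still (1130829, 1121878),
      still (1034141, 1211584), still (930363, 1292984), still (820207, 1365520),
      still (156505, 1727662), still (-552262, 1493722), still (-656338, 1451007),
      still (-757138, 1401050), still (-2303815, 493210), still (-2403815, 393210)]\<rparr>"

definition cert_4200 :: certificate where
  "cert_4200 = \<lparr>half_widths = (2100000, 2150000), rect_centre = (-286340, -26799),
     tri_dir = (6870387, -2596684, 7344725), tri_vertex = (-2436341, -396878),
     tri_box1 = (681718, -1575359), tri_box2 = (143282, 1714200),
     polygon = [
      still (-2436341, -396878), still (-2386340, -426799), still (-753014, -1404137),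
      still (-617977, -1468583), still (-477491, -1520077), still (-332793, -1558166),
      still (-185160, -1582513), still (-35895, -1592904), still (681719, -1575361),
      still (1133225, -1117514), still (1863660, -376799), still (1863660, 323201),
      still (1124661, 1128356), still (1020025, 1223763), still (907332, 1309503),
      still (787470, 1384897), still (143283, 1714203), still (-544542, 1497069),
      still (-671353, 1444655), still (-793182, 1381523), still (-2386340, 373201),
      still (-2436340, 323201)]\<rparr>"

text \<open>The certificates before this one have still polygons, which cover all rectangles of
  their range at once. From here up to \<open>cert_4725\<close>, closer to the peak, some or all of
  the rectangle's corners are moving vertices.\<close>

definition cert_4300 :: certificate where
  "cert_4300 = \<lparr>half_widths = (2150000, 2225000), rect_centre = (-285196, -24563),
     tri_dir = (7861304, -3374970, 8555146), tri_vertex = (-2511696, -298062),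
     tri_box1 = (551296, -1613049), tri_box2 = (158611, 1697074),
     polygon = [
      still (-2511696, -298062), ((-2435196, -374563), (-2510196, -299563)),
      still (-789427, -1383727), still (-665433, -1447444), still (-536344, -1500076),
      still (-403147, -1541222), still (-266863, -1570566), still (-128536, -1587883),
      still (551297, -1613051), still (1079587, -1171986),
      ((1864804, -374563), (1939804, -299563)), ((1864804, 325437), (1939804, 250437)),
      still (1120571, 1132557), still (1012191, 1230379), still (895312, 1317870),
      still (770914, 1394294), still (158612, 1697077), still (-488396, 1516022),
      still (-604460, 1473595), still (-716885, 1422297), still (-824994, 1362438),
      ((-2435196, 325437), (-2510196, 250437))]\<rparr>"

definition cert_4450 :: certificate where
  "cert_4450 = \<lparr>half_widths = (2225000, 2275000), rect_centre = (269869, 16744),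
     tri_dir = (3776091, 2677300, 4628909), tri_vertex = (-171840, -1688711),
     tri_box1 = (2547368, 239245), tri_box2 = (-481895, 1630170),
     polygon = [
      ((-1955131, -258256), (-2005131, -208256)), still (-1118081, -1133623),
      still (-1049831, -1197106), still (-977983, -1256486), still (-902783, -1311560),
      still (-824489, -1362140), still (-743370, -1408051), still (-171840, -1688711),
      still (451435, -1527132), still (553459, -1493188), still (652959, -1452436),
      still (749482, -1405063), still (842589, -1351284),
      ((2494869, -258256), (2544869, -208256)), still (2547371, 239246),
      ((2494869, 291744), (2544869, 241744)), still (826498, 1361055), still (738852, 1410555),
      still (648254, 1454419), still (555066, 1492471), still (459660, 1524559),
      still (362417, 1550556), still (263725, 1570356), still (163980, 1583881),
      still (-481895, 1630173), still (-988554, 1247879), still (-1046235, 1199931),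
      still (-1101592, 1149320), ((-1955131, 291744), (-2005131, 241744))]\<rparr>"

definition cert_4550 :: certificate where
  "cert_4550 = \<lparr>half_widths = (2275000, 2300000), rect_centre = (264197, -13845),
     tri_dir = (6775440, 3199858, 7493042), tri_vertex = (-448405, -1635824),
     tri_box1 = (2565697, -212345), tri_box2 = (-174124, 1686205),
     polygon = [
      ((-2010803, -238845), (-2035803, -213845)), still (-1102862, -1147961),
      still (-1054450, -1192583), still (-1004234, -1235165), still (-952301, -1275634),
      still (-448405, -1635824), still (168846, -1582914), still (234394, -1574543),
      still (299538, -1563459), still (364167, -1549680), still (428167, -1533232),
      still (491430, -1514141), still (553846, -1492441), still (615308, -1468170),
      still (675709, -1441369), still (734946, -1412084), still (792917, -1380366),
      still (849521, -1346269), ((2539197, -238845), (2564197, -213845)),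
      still (2565700, -212345), ((2539197, 211155), (2564197, 186155)), still (863617, 1337307),
      still (804902, 1373447), still (744678, 1407011), still (683056, 1437935),
      still (620153, 1466163), still (556087, 1491640), still (490978, 1514320),
      still (424948, 1534159), still (-174124, 1686208), still (-729548, 1414916),
      still (-790253, 1381929), still (-849471, 1346339), still (-907088, 1308213),
      still (-962996, 1267622), still (-1017091, 1224645), still (-1069270, 1179360),
      still (-1119435, 1131854), ((-2010803, 211155), (-2035803, 186155))]\<rparr>"

text \<open>This range contains the peak near 0.463. With so little area to spare, the arcs are
  followed from outside by many short edges.\<close>

definition cert_4600 :: certificate where
  "cert_4600 = \<lparr>half_widths = (2300000, 2320000), rect_centre = (-248837, 12620),
     tri_dir = (1450456, -979110, 1749994), tri_vertex = (-2583902, 182508),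
     tri_box1 = (178880, -1682470), tri_box2 = (412607, 1642659),
     polygon = [
      still (-2583902, 182508), ((-2548837, -187380), (-2568837, -167380)),
      still (-888087, -1320820), still (-862823, -1337460), still (-837247, -1353618),
      still (-811369, -1369286), still (-785197, -1384460), still (-758742, -1399133),
      still (-732013, -1413301), still (-705019, -1426959), still (-677771, -1440101),
      still (-650278, -1452723), still (-622549, -1464820), still (-594596, -1476387),
      still (-566428, -1487422), still (-538056, -1497919), still (-509489, -1507874),
      still (-480738, -1517285), still (-451813, -1526148), still (-422725, -1534460),
      still (-393485, -1542217), still (178881, -1682472), still (709665, -1424663),
      still (738001, -1410192), still (766043, -1395158), still (793778, -1379567),
      still (821196, -1363424), still (848286, -1346736), still (875037, -1329510),
      still (901439, -1311753), still (927480, -1293472), still (953150, -1274674),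
      still (978440, -1255366), still (1003339, -1235557), still (1027836, -1215253),
      still (1051923, -1194465), still (1075590, -1173199), still (1098826, -1151464),
      still (1121624, -1129269), ((2051163, -187380), (2071163, -167380)),
      ((2051163, 212620), (2071163, 192620)), still (1107231, 1143366), still (1086082, 1163475),
      still (1064567, 1183193), still (1042694, 1202513), still (1020470, 1221429),
      still (997904, 1239934), still (975002, 1258022), still (951772, 1275688),
      still (928222, 1292924), still (904360, 1309726), still (412608, 1642662),
      still (-179046, 1581524), still (-209892, 1577727), still (-240658, 1573328),
      still (-271332, 1568329), still (-301902, 1562732), still (-332357, 1556540),
      still (-362686, 1549753), still (-392876, 1542376), still (-422917, 1534411),
      still (-452796, 1525861), still (-482503, 1516729), still (-512025, 1507019),
      still (-541353, 1496734), still (-570474, 1485879), still (-599377, 1474457),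
      still (-628052, 1462473), still (-656488, 1449931), still (-684673, 1436837),
      still (-712597, 1423194), still (-740250, 1409009), still (-767620, 1394287),
      still (-794698, 1379033), still (-821472, 1363254), still (-847933, 1346954),
      still (-874072, 1330141), ((-2548837, 212620), (-2568837, 192620))]\<rparr>"

definition cert_4640 :: certificate where
  "cert_4640 = \<lparr>half_widths = (2320000, 2335000), rect_centre = (-247466, 11409),
     tri_dir = (2563617, -1721344, 3087905), tri_vertex = (-2584940, 174640),
     tri_box1 = (182434, -1683518), tri_box2 = (407958, 1642178),
     polygon = [
      still (-2584940, 174640), ((-2567466, -168591), (-2582466, -153591)),
      still (-890401, -1319262), still (-865061, -1336015), still (-839406, -1352281),
      still (-813445, -1368055), still (-787188, -1383330), still (-760644, -1398101),
      still (-733823, -1412363), still (-706734, -1426111), still (-679389, -1439339),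
      still (-651795, -1452043), still (-623964, -1464218), still (-595906, -1475860),
      still (-567631, -1486964), still (-539150, -1497526), still (-510471, -1507543),
      still (-481607, -1517010), still (-452568, -1525925), still (-423363, -1534285),
      still (-394004, -1542085), still (182435, -1683520), still (715596, -1421690),
      still (743388, -1407357), still (770893, -1392481), still (798101, -1377068),
      still (825000, -1361123), still (851581, -1344652), still (877833, -1327663),
      still (903746, -1310161), still (929311, -1292154), still (954517, -1273647),
      still (979354, -1254649), still (1003813, -1235167), still (1027885, -1215208),
      still (1051561, -1194780), still (1074830, -1173891), still (1097684, -1152549),
      still (1120115, -1130762), ((2072534, -168591), (2087534, -153591)),
      ((2072534, 191409), (2087534, 176409)), still (1106974, 1143621), still (1085211, 1164293),
      still (1063062, 1184550), still (1040535, 1204386), still (1017639, 1223794),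
      still (994380, 1242767), still (970768, 1261297), still (946810, 1279379),
      still (922516, 1297006), still (897893, 1314172), still (407959, 1642181),
      still (-179136, 1581515), still (-210162, 1577692), still (-241108, 1573260),
      still (-271960, 1568221), still (-302708, 1562577), still (-333339, 1556331),
      still (-363841, 1549484), still (-394203, 1542039), still (-424413, 1533999),
      still (-454459, 1525368), still (-484330, 1516148), still (-514014, 1506343),
      still (-543499, 1495957), still (-572775, 1484994), still (-601830, 1473458),
      still (-630653, 1461354), still (-659233, 1448686), still (-687558, 1435459),
      still (-715618, 1421679), still (-743402, 1407350), still (-770899, 1392478),
      still (-798099, 1377069), still (-824991, 1361128), still (-851564, 1344663),
      still (-877809, 1327679), ((-2567466, 191409), (-2582466, 176409))]\<rparr>"

definition cert_4660 :: certificate where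
  "cert_4660 = \<lparr>half_widths = (2330000, 2350000), rect_centre = (-232495, 4302),
     tri_dir = (936169, -607800, 1116169), tri_vertex = (-2606065, 136920),
     tri_box1 = (189715, -1678218), tri_box2 = (363780, 1650568),
     polygon = [
      still (-2606065, 136920), ((-2562495, -165698), (-2582495, -145698)),
      still (-888063, -1320952), still (-849306, -1346198), still (-809832, -1370307),
      still (-769674, -1393260), still (-728866, -1415035), still (-687442, -1435616),
      still (-645438, -1454984), still (-602889, -1473124), still (-559831, -1490020),
      still (-516300, -1505658), still (-472333, -1520024), still (-427967, -1533106),
      still (-383240, -1544894), still (189716, -1678220), still (718819, -1420172),
      still (760505, -1398292), still (801526, -1375189), still (841845, -1350884),
      still (881428, -1325396), still (920239, -1298749), still (958246, -1270966),
      still (995414, -1242071), still (1031712, -1212089), still (1067107, -1181047),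
      still (1101568, -1148972), ((2097505, -165698), (2117505, -145698)),
      ((2097505, 174302), (2117505, 154302)), still (1098112, 1152233), still (1066824, 1181261),
      still (1034770, 1209439), still (1001971, 1236748), still (968452, 1263167),
      still (934237, 1288678), still (899350, 1313263), still (863817, 1336904),
      still (363781, 1650571), still (-224130, 1575869), still (-270961, 1568495),
      still (-317551, 1559730), still (-363860, 1549582), still (-409846, 1538058),
      still (-455468, 1525171), still (-500687, 1510930), still (-545461, 1495349),
      still (-589751, 1478442), still (-633518, 1460223), still (-676724, 1440709),
      still (-719329, 1419917), still (-761295, 1397865), still (-802587, 1374573),
      still (-843166, 1350062), still (-882998, 1324353), ((-2562495, 174302), (-2582495, 154302))]\<rparr>"

text \<open>The first polygon vertex starts slightly beyond the triangle's vertex: otherwise the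
  edge leading back to it would cut off the rectangle's upper left corner.\<close>

definition cert_4700 :: certificate where
  "cert_4700 = \<lparr>half_widths = (2350000, 2362500), rect_centre = (-217823, 10611),
     tri_dir = (140439, -90160, 166889), tri_vertex = (-2620387, 123758),
     tri_box1 = (184651, -1677040), tri_box2 = (341668, 1652593),
     polygon = [
      ((-2621386, 123805), (-2620387, 123758)), ((-2567823, -139389), (-2580323, -126889)),
      still (-886357, -1322453), still (-821548, -1363660), still (-754828, -1401694),
      still (-686350, -1436465), still (-616276, -1467894), still (-544767, -1495907),
      still (-471991, -1520439), still (-398116, -1541432), still (184652, -1677042),
      still (728468, -1415717), still (804551, -1373906), still (878242, -1328010),
      still (949322, -1278165), still (1017580, -1224521), still (1082812, -1167235),
      ((2132177, -139389), (2144677, -126889)), ((2132177, 160611), (2144677, 148111)),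
      still (1076280, 1172989), still (1023200, 1219567), still (968105, 1263746),
      still (911106, 1305438), still (852314, 1344561), still (341669, 1652596),
      still (-255431, 1571469), still (-337053, 1556006), still (-417757, 1536307),
      still (-497324, 1512425), still (-575536, 1484425), still (-652182, 1452384),
      still (-727052, 1416388), still (-799943, 1376536), still (-870656, 1332936)]\<rparr>"

text \<open>The vertex near the triangle's right tip starts slightly beyond it, to keep the
  rectangle's lower right corner inside the edge arriving there.\<close>

definition cert_4725 :: certificate where
  "cert_4725 = \<lparr>half_widths = (2362500, 2375000), rect_centre = (186342, -4915),
     tri_dir = (3827304, 2083690, 4357754), tri_vertex = (-270878, -1659578),
     tri_box1 = (2656703, -65722), tri_box2 = (-187408, 1672710),
     polygon = [
      ((-2176158, -142415), (-2188658, -129915)), still (-1050285, -1196941),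
      still (-969490, -1263272), still (-884516, -1324160), still (-795731, -1379340),
      still (-270878, -1659578), still (323253, -1559524), still (439337, -1530880),
      still (552944, -1493607), still (663435, -1447917), still (770187, -1394066),
      still (872599, -1332359), ((2656949, -65728), (2656706, -65722)),
      ((2548842, 132585), (2561342, 120085)), still (884922, 1323936), still (794098, 1380326),
      still (699696, 1430496), still (602140, 1474218), still (501871, 1511297),
      still (399339, 1541564), still (-187408, 1672713), still (-738895, 1411026),
      still (-847526, 1348577), still (-950912, 1277782), still (-1048413, 1199079),
      ((-2176158, 132585), (-2188658, 120085))]\<rparr>"

definition cert_4750 :: certificate where
  "cert_4750 = \<lparr>half_widths = (2375000, 2400000), rect_centre = (-175400, -3636),
     tri_dir = (2397549, -1382020, 2767349), tri_vertex = (-2678704, -2998),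
     tri_box1 = (209197, -1667672), tri_box2 = (206896, 1665660),
     polygon = [
      still (-2678704, -2998), still (-2550400, -128636), still (-897796, -1314678),
      still (-835482, -1355133), still (-771349, -1392636), still (-705537, -1427107),
      still (-638187, -1458469), still (-569448, -1486655), still (-499469, -1511604),
      still (-428402, -1533260), still (-356402, -1551577), still (209198, -1667674),
      still (730590, -1414505), still (799619, -1376660), still (866694, -1335450),
      still (931649, -1290974), still (994327, -1243342), still (1054573, -1192669),
      still (2199600, -128636), still (2224600, -103636), still (2224600, 96364),
      still (2199600, 121364), still (1062112, 1185816), still (1009375, 1231018),
      still (954715, 1273876), still (898238, 1314309), still (840051, 1352241),
      still (780265, 1387598), still (718994, 1420313), still (206897, 1665663),
      still (-352533, 1552474), still (-425562, 1534063), still (-497640, 1512220),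
      still (-568603, 1486991), still (-638294, 1458435), still (-706557, 1426615),
      still (-773238, 1391602), still (-838189, 1353474), still (-901263, 1312318),
      still (-2550400, 121364)]\<rparr>"

definition cert_4800 :: certificate where
  "cert_4800 = \<lparr>half_widths = (2400000, 2500000), rect_centre = (161741, 885),
     tri_dir = (5408787, 3123716, 6246005), tri_vertex = (-187855, -1666087),
     tri_box1 = (2698676, 960), tri_box2 = (-188295, 1667246),
     polygon = [
      still (-2338259, 885), still (-2238259, -99115), still (-1034086, -1211444),
      still (-936051, -1288696), still (-832269, -1358035), still (-723375, -1419034),
      still (-187855, -1666087), still (394147, -1543448), still (523285, -1504578),
      still (648673, -1454924), still (769412, -1394843), still (884636, -1324764),
      still (2561741, -99115), still (2698679, 961), still (884039, 1325142),
      still (769535, 1394755), still (649585, 1454498), still (525038, 1503948),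
      still (396776, 1542755), still (-188295, 1667249), still (-726123, 1417602),
      still (-833823, 1357053), still (-936504, 1288337), still (-1033551, 1211868),
      still (-2238259, 100885)]\<rparr>"

section \<open>Integer verification of the certificates\<close>

lemma valid_cert_2500: "valid cert_2500"
  by code_simp

lemma valid_cert_3500: "valid cert_3500"
  by code_simp

lemma valid_cert_3800: "valid cert_3800"
  by code_simp

lemma valid_cert_4000: "valid cert_4000"
  by code_simp

lemma valid_cert_4200: "valid cert_4200"
  by code_simp

lemma valid_cert_4300: "valid cert_4300"
  by code_simp

lemma valid_cert_4450: "valid cert_4450"
  by code_simp

lemma valid_cert_4550: "valid cert_4550"
  by code_simp

lemma valid_cert_4600: "valid cert_4600"
  by code_simp

lemma valid_cert_4640: "valid cert_4640"
  by code_simp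

lemma valid_cert_4660: "valid cert_4660"
  by code_simp

lemma valid_cert_4700: "valid cert_4700"
  by code_simp

lemma valid_cert_4725: "valid cert_4725"
  by code_simp

lemma valid_cert_4750: "valid cert_4750"
  by code_simp

lemma valid_cert_4800: "valid cert_4800"
  by code_simp

section \<open>Assembling the ranges of the longer side\<close>

lemma exists_cover_longer_side:
  assumes "1 / 4 \<le> a" "a \<le> 1 / 2" and ab: "a + b = 1 / 2"
  shows "\<exists>K. convex K \<and> emeasure lebesgue K \<le> ennreal 0.09763 \<and>
    contains_congruent_copy K (rectangle a b) \<and> contains_congruent_copy K circle_perim1 \<and>
    contains_congruent_copy K triangle_perim1"
proof -
  \<comment> \<open>Units of \<open>a\<close> as in the suffixes of the certificates.\<close>
  have x: "2500 \<le> 10000 * a" "10000 * a \<le> 5000"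
    using assms by auto
  consider "2500 \<le> 10000 * a" "10000 * a \<le> 3500"
    | "3500 \<le> 10000 * a" "10000 * a \<le> 3800"
    | "3800 \<le> 10000 * a" "10000 * a \<le> 4000"
    | "4000 \<le> 10000 * a" "10000 * a \<le> 4200"
    | "4200 \<le> 10000 * a" "10000 * a \<le> 4300"
    | "4300 \<le> 10000 * a" "10000 * a \<le> 4450"
    | "4450 \<le> 10000 * a" "10000 * a \<le> 4550"
    | "4550 \<le> 10000 * a" "10000 * a \<le> 4600"
    | "4600 \<le> 10000 * a" "10000 * a \<le> 4640"
    | "4640 \<le> 10000 * a" "10000 * a \<le> 4670"
    | "4670 \<le> 10000 * a" "10000 * a \<le> 4700"
    | "4700 \<le> 10000 * a" "10000 * a \<le> 4725"
    | "4725 \<le> 10000 * a" "10000 * a \<le> 4750"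
    | "4750 \<le> 10000 * a" "10000 * a \<le> 4800"
    | "4800 \<le> 10000 * a" "10000 * a \<le> 5000"
    using x linear[of "10000 * a"] by meson
  then show ?thesis
  proof cases
    case 1
    then show ?thesis
      by (intro valid_imp_cover[OF valid_cert_2500 _ _ _ _ ab]) (auto simp: cert_2500_def)
  next
    case 2
    then show ?thesis
      by (intro valid_imp_cover[OF valid_cert_3500 _ _ _ _ ab]) (auto simp: cert_3500_def)
  next
    case 3
    then show ?thesis
      by (intro valid_imp_cover[OF valid_cert_3800 _ _ _ _ ab]) (auto simp: cert_3800_def)
  next
    case 4
    then show ?thesis
      by (intro valid_imp_cover[OF valid_cert_4000 _ _ _ _ ab]) (auto simp: cert_4000_def)
  next
    case 5
    then show ?thesis
      by (intro valid_imp_cover[OF valid_cert_4200 _ _ _ _ ab]) (auto simp: cert_4200_def)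
  next
    case 6
    then show ?thesis
      by (intro valid_imp_cover[OF valid_cert_4300 _ _ _ _ ab]) (auto simp: cert_4300_def)
  next
    case 7
    then show ?thesis
      by (intro valid_imp_cover[OF valid_cert_4450 _ _ _ _ ab]) (auto simp: cert_4450_def)
  next
    case 8
    then show ?thesis
      by (intro valid_imp_cover[OF valid_cert_4550 _ _ _ _ ab]) (auto simp: cert_4550_def)
  next
    case 9
    then show ?thesis
      by (intro valid_imp_cover[OF valid_cert_4600 _ _ _ _ ab]) (auto simp: cert_4600_def)
  next
    case 10
    then show ?thesis
      by (intro valid_imp_cover[OF valid_cert_4640 _ _ _ _ ab]) (auto simp: cert_4640_def)
  next
    \<comment> \<open>The range of \<open>cert_4660\<close> starts at 0.466 and overlaps that of
      \<open>cert_4640\<close>; the switch is made at 0.467, where the latter ends.\<close>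
    case 11
    then show ?thesis
      by (intro valid_imp_cover[OF valid_cert_4660 _ _ _ _ ab]) (auto simp: cert_4660_def)
  next
    case 12
    then show ?thesis
      by (intro valid_imp_cover[OF valid_cert_4700 _ _ _ _ ab]) (auto simp: cert_4700_def)
  next
    case 13
    then show ?thesis
      by (intro valid_imp_cover[OF valid_cert_4725 _ _ _ _ ab]) (auto simp: cert_4725_def)
  next
    case 14
    then show ?thesis
      by (intro valid_imp_cover[OF valid_cert_4750 _ _ _ _ ab]) (auto simp: cert_4750_def)
  next
    case 15
    then show ?thesis
      by (intro valid_imp_cover[OF valid_cert_4800 _ _ _ _ ab]) (auto simp: cert_4800_def)
  qed
qed

theorem theorem2:
  fixes a b :: real
  assumes "a > 0" and "b > 0" and "2 * (a + b) = 1"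
  shows "\<exists>K :: complex set. convex K \<and> emeasure lebesgue K \<le> ennreal 0.09763 \<and>
           contains_congruent_copy K (rectangle a b) \<and>
           contains_congruent_copy K circle_perim1 \<and>
           contains_congruent_copy K triangle_perim1"
proof (cases "b \<le> a")
  case True
  then show ?thesis
    using assms by (intro exists_cover_longer_side) auto
next
  case False
  \<comment> \<open>Now \<open>b\<close> is the longer side: a cover for the rectangle with sides
    exchanged serves after a quarter turn.\<close>
  then have "1 / 4 \<le> b" "b \<le> 1 / 2" "b + a = 1 / 2"
    using assms by auto
  from exists_cover_longer_side[OF this] show ?thesis
    using contains_congruent_copy_rectangle_swap by blast
qed

end
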